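(* Let $\mathfrak{O}$ be the valuation ring of a non-Archimedean local field of arbitrary characteristic, with residue field size $q$. Then $$\mathsf{Z}_{\mathrm{Sym}_d(\mathfrak{O})}(T) = \mathsf{Z}_{\mathfrak{gl}_d(\mathfrak{O})}(T) = \frac{1-q^{-d}T}{(1-T)^2}.$$
   Context: $\mathfrak{gl}_d(\mathfrak{O})=\mathrm{M}_d(\mathfrak{O})$ and $\mathrm{Sym}_d(\mathfrak{O})=\{a\in\mathrm{M}_d(\mathfrak{O}): a^\top=a\}$. Let $\mathfrak{P}$ be the maximal ideal of $\mathfrak{O}$ and $\mathfrak{O}_n=\mathfrak{O}/\mathfrak{P}^n$. For an $\mathfrak{O}$-submodule $M\subset\mathrm{M}_{d}(\mathfrak{O})$, let $M_n$ be its image in $\mathrm{M}_{d}(\mathfrak{O}_n)$ under entrywise reduction. The ask zeta function of $M$ is $\mathsf{Z}_M(T)=\sum_{n=0}^\infty \bigl(|M_n|^{-1}\sum_{a\in M_n}|\mathrm{Ker}(a)|\bigr)T^n$, where $\mathrm{Ker}(a)=\{x\in\mathfrak{O}_n^d: xa=0\}$ (row vectors). *)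

theory Defs
  imports
    "HOL-Analysis.Abstract_Metric_Spaces"
    "HOL-Analysis.Abstract_Topological_Spaces"
    "HOL-Algebra.Ideal_Product"
    "HOL-Algebra.QuotRing"
    "HOL-Computational_Algebra.Formal_Power_Series"
    "Jordan_Normal_Form.Matrix"
begin

text \<open>Outside the carrier the value of the distance is irrelevant. It is set to 0 because
  the locale \<^locale>\<open>Metric_space\<close> requires non-negativity and symmetry for all arguments.\<close>

definition abs_dist :: "('a, 'b) ring_scheme \<Rightarrow> ('a \<Rightarrow> real) \<Rightarrow> 'a \<Rightarrow> 'a \<Rightarrow> real" where
  "abs_dist K v x y = (if x \<in> carrier K \<and> y \<in> carrier K then v (x \<ominus>\<^bsub>K\<^esub> y) else 0)"

locale nonarch_abs = field K for K (structure) +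
  fixes v :: "'a \<Rightarrow> real"
  assumes abs_nonneg: "x \<in> carrier K \<Longrightarrow> 0 \<le> v x"
    and abs_eq_0_iff: "x \<in> carrier K \<Longrightarrow> v x = 0 \<longleftrightarrow> x = \<zero>"
    and abs_mult: "\<lbrakk>x \<in> carrier K; y \<in> carrier K\<rbrakk> \<Longrightarrow> v (x \<otimes> y) = v x * v y"
    and abs_ultrametric: "\<lbrakk>x \<in> carrier K; y \<in> carrier K\<rbrakk> \<Longrightarrow> v (x \<oplus> y) \<le> max (v x) (v y)"
begin

lemma abs_one: "v \<one> = 1"
proof -
  have "v \<one> * v \<one> = v \<one>" using abs_mult[of \<one> \<one>] by simp
  moreover have "v \<one> \<noteq> 0" using abs_eq_0_iff[of \<one>] by simp
  ultimately show ?thesis by simp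
qed

lemma abs_uminus: assumes x: "x \<in> carrier K" shows "v (\<ominus> x) = v x"
proof -
  have "v (\<ominus> x) * v (\<ominus> x) = v x * v x"
    using abs_mult[of "\<ominus> x" "\<ominus> x"] abs_mult[of x x] x by (simp add: l_minus r_minus)
  then show ?thesis
    using abs_nonneg[of x] abs_nonneg[of "\<ominus> x"] x by (simp flip: power2_eq_square)
qed

lemma Metric_space_abs_dist: "Metric_space (carrier K) (abs_dist K v)"
proof
  show "0 \<le> abs_dist K v x y" for x y
    by (simp add: abs_dist_def abs_nonneg)
  show "abs_dist K v x y = abs_dist K v y x" for x y
  proof (cases "x \<in> carrier K \<and> y \<in> carrier K")
    case True
    then have "\<ominus> (x \<ominus> y) = y \<ominus> x" by algebra
    with True abs_uminus[of "x \<ominus> y"] show ?thesis by (simp add: abs_dist_def)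
  qed (auto simp: abs_dist_def)
  show "abs_dist K v x y = 0 \<longleftrightarrow> x = y" if "x \<in> carrier K" "y \<in> carrier K" for x y
  proof -
    have "x \<ominus> y = \<zero> \<longleftrightarrow> x = y"
      using that minus_equality[of x "\<ominus> y"] by (auto simp: minus_eq r_neg)
    then show ?thesis using that by (simp add: abs_dist_def abs_eq_0_iff)
  qed
  show "abs_dist K v x z \<le> abs_dist K v x y + abs_dist K v y z"
    if xyz: "x \<in> carrier K" "y \<in> carrier K" "z \<in> carrier K" for x y z
  proof -
    have "(x \<ominus> y) \<oplus> (y \<ominus> z) = x \<ominus> z" using xyz by algebra
    then have "v (x \<ominus> z) \<le> max (v (x \<ominus> y)) (v (y \<ominus> z))"
      using abs_ultrametric[of "x \<ominus> y" "y \<ominus> z"] xyz by simp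
    moreover have "0 \<le> v (x \<ominus> y)" "0 \<le> v (y \<ominus> z)" using xyz by (auto intro: abs_nonneg)
    ultimately show ?thesis using xyz by (simp add: abs_dist_def)
  qed
qed

end

locale nonarch_local_field = nonarch_abs +
  assumes abs_nontrivial: "\<exists>x \<in> carrier K. x \<noteq> \<zero> \<and> v x \<noteq> 1"
    and locally_compact: "locally_compact_space (Metric_space.mtopology (carrier K) (abs_dist K v))"

definition valuation_ring :: "('a, 'b) ring_scheme \<Rightarrow> ('a \<Rightarrow> real) \<Rightarrow> ('a, 'b) ring_scheme" where
  "valuation_ring K v = K\<lparr>carrier := {x \<in> carrier K. v x \<le> 1}\<rparr>"

text \<open>\<^const>\<open>ideals_set\<close> is the monoid of ideals of \<open>R\<close> under multiplication, with unit
  \<open>carrier R\<close>; in particular \<open>quot_pow R P 0\<close> is the zero ring.\<close>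

definition ideal_pow :: "('a, 'b) ring_scheme \<Rightarrow> 'a set \<Rightarrow> nat \<Rightarrow> 'a set" where
  "ideal_pow R P n = P [^]\<^bsub>ideals_set R\<^esub> n"

definition quot_pow :: "('a, 'b) ring_scheme \<Rightarrow> 'a set \<Rightarrow> nat \<Rightarrow> 'a set ring" where
  "quot_pow R P n = R Quot (ideal_pow R P n)"

definition gl_mat :: "nat \<Rightarrow> ('a, 'b) ring_scheme \<Rightarrow> 'a mat set" where
  "gl_mat d R = {a \<in> carrier_mat d d. elements_mat a \<subseteq> carrier R}"

definition Sym_mat :: "nat \<Rightarrow> ('a, 'b) ring_scheme \<Rightarrow> 'a mat set" where
  "Sym_mat d R = {a \<in> gl_mat d R. transpose_mat a = a}"

definition reduce_mats :: "('a, 'b) ring_scheme \<Rightarrow> 'a set \<Rightarrow> 'a mat set \<Rightarrow> nat \<Rightarrow> 'a set mat set" where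
  "reduce_mats R P M n = map_mat (\<lambda>x. ideal_pow R P n +>\<^bsub>R\<^esub> x) ` M"

text \<open>Left kernel of a matrix over the ring \<open>S\<close>, i.e. the row vectors \<open>x\<close> with \<open>x a = 0\<close>. The product
  is written out because the arithmetic of \<open>S\<close> lives in the record, not in a type class.\<close>

definition ker_mat :: "('a, 'b) ring_scheme \<Rightarrow> 'a mat \<Rightarrow> 'a vec set" where
  "ker_mat S a = {x \<in> carrier_vec (dim_row a).
     (\<forall>i < dim_row a. x $ i \<in> carrier S) \<and>
     (\<forall>j < dim_col a. (\<Oplus>\<^bsub>S\<^esub>i \<in> {..<dim_row a}. x $ i \<otimes>\<^bsub>S\<^esub> a $$ (i, j)) = \<zero>\<^bsub>S\<^esub>)}"

definition ask_zeta :: "('a, 'b) ring_scheme \<Rightarrow> 'a set \<Rightarrow> 'a mat set \<Rightarrow> rat fps" where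
  "ask_zeta R P M = Abs_fps (\<lambda>n.
     (\<Sum>a \<in> reduce_mats R P M n. of_nat (card (ker_mat (quot_pow R P n) a)))
       / of_nat (card (reduce_mats R P M n)))"

end

theory Submission
  imports
    Defs
    "HOL-Algebra.Subrings"
begin

text \<open>Let \<open>O\<close> be the valuation ring, \<open>P\<close> its maximal ideal and \<open>S = O/P\<^sup>n\<close>. Let \<open>M\<close> be either the
  set of all \<open>d \<times> d\<close> matrices over \<open>S\<close> or the set of symmetric ones.

  The sum of the \<open>|Ker a|\<close> over \<open>a\<close> in \<open>M\<close> counts the pairs \<open>(x, a)\<close> with \<open>xa = 0\<close>. For a fixed row
  vector \<open>x\<close> the map \<open>a \<mapsto> xa\<close> is additive, so \<open>|M| / |xM|\<close> matrices kill \<open>x\<close>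
  (\<open>card_mats_eq_image_times_kernel\<close>). If \<open>p\<close> is a uniformizer and \<open>x \<noteq> 0\<close> is divisible by exactly
  \<open>p\<^sup>k\<close>, then \<open>x = p\<^sup>k y\<close> where \<open>y\<close> has a unit coordinate. For such \<open>y\<close> one has \<open>yM = S\<^sup>d\<close>. This is
  plain for all matrices, and it remains true for the symmetric ones, because a symmetric matrix supported
  in a single row and the same column already suffices (\<open>Sym_mat_transitive\<close>). Hence \<open>xM\<close> is the
  set of all vectors divisible by \<open>p\<^sup>k\<close> (\<open>image_vec_times\<close>), and the two families of matrices are
  indistinguishable from here on.

  The number \<open>N\<^sub>k\<close> of vectors divisible by \<open>p\<^sup>k\<close> satisfies \<open>N\<^sub>k = q\<^sup>d N\<^sub>k\<^sub>+\<^sub>1\<close> for \<open>k < n\<close>. So the vectors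
  divisible by exactly \<open>p\<^sup>k\<close> contribute \<open>(N\<^sub>k - N\<^sub>k\<^sub>+\<^sub>1) / N\<^sub>k = 1 - q\<^sup>-\<^sup>d\<close> to the average, for each
  \<open>k < n\<close>, and the zero vector contributes \<open>1\<close>. The \<open>n\<close>-th coefficient of the zeta function is
  therefore \<open>1 + n (1 - q\<^sup>-\<^sup>d)\<close> (\<open>average_kernel\<close>), and summing the series gives the stated fraction.

  The count rests on two properties of the finite ring \<open>S\<close>: \<open>p\<close> has nilpotency index \<open>n\<close>, and every
  nonunit is a multiple of \<open>p\<close>. Both, and the finiteness of \<open>S\<close>, are inherited from \<open>O\<close> through local
  compactness: \<open>O\<close> is totally bounded, so \<open>v\<close> attains a largest value below \<open>1\<close>, and balls of positive
  radius have finite index in \<open>O\<close> (\<open>quotient_finite_chain_ring\<close>).\<close>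

(* In this theory, $ is the entry function of vectors of arbitrary dimension. *)
no_notation Finite_Cartesian_Product.vec.vec_nth (infixl \<open>$\<close> 90)

section \<open>Finite chain rings\<close>

text \<open>A finite chain ring with uniformizer \<open>p\<close> and nilpotency index exactly \<open>n\<close>; the model is
  \<open>O/P\<^sup>n\<close>. The set \<open>D\<close> of digits represents the residue field. Working with representatives
  places the residue field inside the ring, where digits can be multiplied by powers of \<open>p\<close>. For \<open>n = 0\<close> the ring
  is zero and \<open>D\<close> a singleton, whatever the size of the residue field of \<open>O\<close>.\<close>

locale finite_chain_ring = cring S for S (structure) +
  fixes p :: 'a and n :: nat and D :: "'a set"
  assumes finite_carrier: "finite (carrier S)"
    and p_closed [simp]: "p \<in> carrier S"
    and p_pow_n: "p [^] n = \<zero>"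
    and p_pow_nonzero: "k < n \<Longrightarrow> p [^] k \<noteq> \<zero>"
    and nonunit_dvd: "\<lbrakk>x \<in> carrier S; x \<notin> Units S\<rbrakk> \<Longrightarrow> \<exists>s \<in> carrier S. x = p \<otimes> s"
    and D_subset: "D \<subseteq> carrier S"
    and D_rep: "x \<in> carrier S \<Longrightarrow> \<exists>f \<in> D. \<exists>s \<in> carrier S. x = f \<oplus> p \<otimes> s"
    and D_unique: "\<lbrakk>f \<in> D; g \<in> D; s \<in> carrier S; f = g \<oplus> p \<otimes> s\<rbrakk> \<Longrightarrow> f = g"
begin

definition pow_ideal :: "nat \<Rightarrow> 'a set" where
  "pow_ideal k = (\<lambda>s. p [^] k \<otimes> s) ` carrier S"

lemma pow_ideal_subset: "pow_ideal k \<subseteq> carrier S"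
  by (auto simp: pow_ideal_def)

lemma pow_ideal_0: "pow_ideal 0 = carrier S"
  by (auto simp: pow_ideal_def image_iff)

lemma pow_ideal_n: "pow_ideal n = {\<zero>}"
  by (auto simp: pow_ideal_def p_pow_n image_iff)

lemma zero_pow_ideal: "\<zero> \<in> pow_ideal k"
  by (auto simp: pow_ideal_def image_iff intro!: bexI[of _ \<zero>])

lemma pow_ideal_Suc_subset: "pow_ideal (Suc k) \<subseteq> pow_ideal k"
proof
  fix x assume "x \<in> pow_ideal (Suc k)"
  then obtain s where s: "s \<in> carrier S" "x = p [^] Suc k \<otimes> s" by (auto simp: pow_ideal_def)
  then have "x = p [^] k \<otimes> (p \<otimes> s)" by (simp add: m_assoc)
  then show "x \<in> pow_ideal k" using s by (auto simp: pow_ideal_def)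
qed

lemma finite_pow_ideal: "finite (pow_ideal k)"
  using finite_subset[OF pow_ideal_subset finite_carrier] .

text \<open>A unit killed by \<open>p\<^sup>k\<close> would force \<open>p\<^sup>k = 0\<close>, so below the nilpotency index only
  multiples of \<open>p\<close> can be killed.\<close>

lemma annihilator_pow:
  assumes x: "x \<in> carrier S" and k: "k < n" and eq: "p [^] k \<otimes> x = \<zero>"
  shows "\<exists>s \<in> carrier S. x = p \<otimes> s"
proof (rule nonunit_dvd[OF x], rule)
  assume u: "x \<in> Units S"
  have "p [^] k = (p [^] k \<otimes> x) \<otimes> inv x" using u x by (simp add: m_assoc)
  also have "\<dots> = \<zero>" unfolding eq using u by simp
  finally show False using p_pow_nonzero[OF k] by simp
qed

text \<open>Every element of \<open>p\<^sup>k S\<close> has exactly one expansion \<open>p\<^sup>k f + y\<close> with a leading digit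
  \<open>f\<close> and a tail \<open>y\<close> in \<open>p\<^sup>k\<^sup>+\<^sup>1 S\<close>. Uniqueness of the digit is where \<open>k < n\<close> enters.\<close>

lemma card_pow_ideal:
  assumes k: "k < n"
  shows "card (pow_ideal k) = card D * card (pow_ideal (Suc k))"
proof -
  have "bij_betw (\<lambda>(f, y). p [^] k \<otimes> f \<oplus> y) (D \<times> pow_ideal (Suc k)) (pow_ideal k)"
    unfolding bij_betw_def
  proof
    show "inj_on (\<lambda>(f, y). p [^] k \<otimes> f \<oplus> y) (D \<times> pow_ideal (Suc k))"
    proof (rule inj_onI, clarify)
      fix f y g z
      assume fg: "f \<in> D" "g \<in> D" and yz: "y \<in> pow_ideal (Suc k)" "z \<in> pow_ideal (Suc k)"
        and eq: "p [^] k \<otimes> f \<oplus> y = p [^] k \<otimes> g \<oplus> z"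
      obtain s t where st: "s \<in> carrier S" "t \<in> carrier S"
        "y = p [^] k \<otimes> p \<otimes> s" "z = p [^] k \<otimes> p \<otimes> t"
        using yz by (auto simp: pow_ideal_def)
      have fgc: "f \<in> carrier S" "g \<in> carrier S" using fg D_subset by auto
      \<comment> \<open>Cancelling the two expansions leaves \<open>p\<^sup>k x = 0\<close>, so \<open>p\<close> divides \<open>x\<close> and hence \<open>f - g\<close>.\<close>
      define x where "x = f \<ominus> (g \<oplus> p \<otimes> (t \<ominus> s))"
      have x: "x \<in> carrier S" using fgc st by (simp add: x_def)
      have pk: "p [^] k \<in> carrier S" by simp
      have "p [^] k \<otimes> x = (p [^] k \<otimes> f \<oplus> y) \<ominus> (p [^] k \<otimes> g \<oplus> z)"
        unfolding x_def st using fgc st(1,2) pk p_closed by algebra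
      also have "\<dots> = \<zero>" unfolding eq using fgc st pk by (simp add: minus_eq r_neg)
      finally obtain u where u: "u \<in> carrier S" "x = p \<otimes> u"
        using annihilator_pow[OF x k] by blast
      have "f = g \<oplus> p \<otimes> (t \<ominus> s) \<oplus> x"
        unfolding x_def using fgc st(1,2) p_closed by algebra
      also have "\<dots> = g \<oplus> p \<otimes> (t \<ominus> s \<oplus> u)"
        unfolding u using fgc st(1,2) u(1) p_closed by algebra
      finally have "f = g" using D_unique[of f g "t \<ominus> s \<oplus> u"] fg st u by simp
      moreover have "y = z"
      proof -
        have "y \<in> carrier S" "z \<in> carrier S" using yz pow_ideal_subset by auto
        then show ?thesis using eq \<open>f = g\<close> fgc by (simp add: a_comm)
      qed
      ultimately show "f = g \<and> y = z" ..
    qed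
    show "(\<lambda>(f, y). p [^] k \<otimes> f \<oplus> y) ` (D \<times> pow_ideal (Suc k)) = pow_ideal k"
    proof (intro equalityI subsetI)
      fix w assume "w \<in> (\<lambda>(f, y). p [^] k \<otimes> f \<oplus> y) ` (D \<times> pow_ideal (Suc k))"
      then obtain f s where fs: "f \<in> D" "s \<in> carrier S" "w = p [^] k \<otimes> f \<oplus> p [^] k \<otimes> p \<otimes> s"
        by (auto simp: pow_ideal_def)
      have f: "f \<in> carrier S" using fs D_subset by auto
      have "w = p [^] k \<otimes> (f \<oplus> p \<otimes> s)"
        unfolding fs using f fs(2) p_closed by (simp add: r_distr m_assoc)
      then show "w \<in> pow_ideal k" using f fs(2) by (auto simp: pow_ideal_def)
    next
      fix w assume "w \<in> pow_ideal k"
      then obtain x where x: "x \<in> carrier S" "w = p [^] k \<otimes> x" by (auto simp: pow_ideal_def)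
      obtain f s where fs: "f \<in> D" "s \<in> carrier S" "x = f \<oplus> p \<otimes> s" using D_rep[OF x(1)] by blast
      have f: "f \<in> carrier S" using fs D_subset by auto
      have "w = p [^] k \<otimes> f \<oplus> p [^] Suc k \<otimes> s"
        unfolding x fs using f fs(2) p_closed by (simp add: r_distr m_assoc)
      moreover have "p [^] Suc k \<otimes> s \<in> pow_ideal (Suc k)"
        unfolding pow_ideal_def using fs(2) by (rule imageI)
      ultimately show "w \<in> (\<lambda>(f, y). p [^] k \<otimes> f \<oplus> y) ` (D \<times> pow_ideal (Suc k))"
        using fs(1) by force
    qed
  qed
  from bij_betw_same_card[OF this] show ?thesis by (simp add: card_cartesian_product)
qed

end

section \<open>Vectors and matrices over a carrier set\<close>

definition vecs_in :: "nat \<Rightarrow> 'a set \<Rightarrow> 'a vec set" where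
  "vecs_in d A = {x \<in> carrier_vec d. \<forall>i < d. x $ i \<in> A}"

lemma bij_betw_vecs_in: "bij_betw (vec d) (PiE {..<d} (\<lambda>_. A)) (vecs_in d A)"
proof (rule bij_betw_byWitness[where f' = "\<lambda>x. restrict (($) x) {..<d}"])
  show "\<forall>f \<in> PiE {..<d} (\<lambda>_. A). restrict (($) (vec d f)) {..<d} = f"
    by (auto simp: fun_eq_iff restrict_def PiE_def extensional_def)
  show "\<forall>x \<in> vecs_in d A. vec d (restrict (($) x) {..<d}) = x"
  proof
    fix x assume "x \<in> vecs_in d A"
    then have "dim_vec x = d" by (simp add: vecs_in_def)
    then show "vec d (restrict (($) x) {..<d}) = x" by (intro eq_vecI) simp_all
  qed
  show "vec d ` PiE {..<d} (\<lambda>_. A) \<subseteq> vecs_in d A"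
    unfolding vecs_in_def by (intro image_subsetI) (simp add: PiE_iff)
  show "(\<lambda>x. restrict (($) x) {..<d}) ` vecs_in d A \<subseteq> PiE {..<d} (\<lambda>_. A)"
    unfolding vecs_in_def by (intro image_subsetI) simp
qed

lemma card_vecs_in: "card (vecs_in d A) = card A ^ d"
  using bij_betw_same_card[OF bij_betw_vecs_in[of d A]] by (simp add: card_PiE)

lemma finite_vecs_in: "finite A \<Longrightarrow> finite (vecs_in d A)"
  using bij_betw_finite[OF bij_betw_vecs_in[of d A]] by (simp add: finite_PiE)

lemma gl_mat_iff:
  "a \<in> gl_mat d S \<longleftrightarrow> a \<in> carrier_mat d d \<and> (\<forall>i<d. \<forall>j<d. a $$ (i, j) \<in> carrier S)"
  unfolding gl_mat_def elements_mat_def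
  by (auto simp: UN_subset_iff image_subset_iff)

lemma finite_gl_mat: assumes "finite (carrier S)" shows "finite (gl_mat d S)"
proof (rule finite_subset)
  show "gl_mat d S \<subseteq> mat d d ` (PiE ({..<d} \<times> {..<d}) (\<lambda>_. carrier S))"
  proof
    fix a assume a: "a \<in> gl_mat d S"
    have "a = mat d d (restrict (($$) a) ({..<d} \<times> {..<d}))"
      using a by (intro eq_matI) (auto simp: gl_mat_def)
    moreover have "restrict (($$) a) ({..<d} \<times> {..<d}) \<in> PiE ({..<d} \<times> {..<d}) (\<lambda>_. carrier S)"
      using a by (auto simp: gl_mat_iff)
    ultimately show "a \<in> mat d d ` (PiE ({..<d} \<times> {..<d}) (\<lambda>_. carrier S))" by blast
  qed
  show "finite (mat d d ` (PiE ({..<d} \<times> {..<d}) (\<lambda>_. carrier S)))"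
    using assms by (intro finite_imageI finite_PiE) auto
qed

lemma Sym_mat_iff:
  "a \<in> Sym_mat d S \<longleftrightarrow> a \<in> gl_mat d S \<and> (\<forall>i<d. \<forall>j<d. a $$ (j, i) = a $$ (i, j))"
proof -
  have "transpose_mat a = a \<longleftrightarrow> (\<forall>i<d. \<forall>j<d. a $$ (j, i) = a $$ (i, j))"
    if "a \<in> carrier_mat d d"
    using that unfolding mat_eq_iff by auto
  then show ?thesis unfolding Sym_mat_def by (auto simp: gl_mat_def)
qed

definition mat_plus :: "('a, 'b) ring_scheme \<Rightarrow> nat \<Rightarrow> 'a mat \<Rightarrow> 'a mat \<Rightarrow> 'a mat" where
  "mat_plus S d a b = mat d d (\<lambda>ij. a $$ ij \<oplus>\<^bsub>S\<^esub> b $$ ij)"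

definition mat_minus :: "('a, 'b) ring_scheme \<Rightarrow> nat \<Rightarrow> 'a mat \<Rightarrow> 'a mat \<Rightarrow> 'a mat" where
  "mat_minus S d a b = mat d d (\<lambda>ij. a $$ ij \<ominus>\<^bsub>S\<^esub> b $$ ij)"

definition vec_times :: "('a, 'b) ring_scheme \<Rightarrow> nat \<Rightarrow> 'a vec \<Rightarrow> 'a mat \<Rightarrow> 'a vec" where
  "vec_times S d x a = vec d (\<lambda>j. \<Oplus>\<^bsub>S\<^esub>i \<in> {..<d}. x $ i \<otimes>\<^bsub>S\<^esub> a $$ (i, j))"

definition zero_vec_in :: "('a, 'b) ring_scheme \<Rightarrow> nat \<Rightarrow> 'a vec" where
  "zero_vec_in S d = vec d (\<lambda>_. \<zero>\<^bsub>S\<^esub>)"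

lemma ker_mat_eq:
  assumes "a \<in> gl_mat d S"
  shows "ker_mat S a = {x \<in> vecs_in d (carrier S). vec_times S d x a = zero_vec_in S d}"
  using assms
  by (auto simp: ker_mat_def gl_mat_def vecs_in_def vec_times_def zero_vec_in_def vec_eq_iff)

lemma (in cring) vec_times_closed:
  assumes "a \<in> gl_mat d R" "x \<in> vecs_in d (carrier R)"
  shows "vec_times R d x a \<in> vecs_in d (carrier R)"
  using assms by (auto simp: vec_times_def vecs_in_def gl_mat_iff intro!: finsum_closed)

lemma (in cring) vec_times_plus:
  assumes "a \<in> gl_mat d R" "b \<in> gl_mat d R" "x \<in> vecs_in d (carrier R)"
  shows "vec_times R d x (mat_plus R d a b)
    = vec d (\<lambda>j. vec_times R d x a $ j \<oplus> vec_times R d x b $ j)"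
proof (rule eq_vecI)
  fix j assume "j < dim_vec (vec d (\<lambda>j. vec_times R d x a $ j \<oplus> vec_times R d x b $ j))"
  then have j: "j < d" by simp
  have "(\<Oplus>i \<in> {..<d}. x $ i \<otimes> mat_plus R d a b $$ (i, j))
      = (\<Oplus>i \<in> {..<d}. x $ i \<otimes> a $$ (i, j) \<oplus> x $ i \<otimes> b $$ (i, j))"
    using assms j by (intro finsum_cong') (auto simp: mat_plus_def gl_mat_iff vecs_in_def r_distr)
  also have "\<dots> = (\<Oplus>i \<in> {..<d}. x $ i \<otimes> a $$ (i, j)) \<oplus> (\<Oplus>i \<in> {..<d}. x $ i \<otimes> b $$ (i, j))"
    using assms j by (intro finsum_addf) (auto simp: gl_mat_iff vecs_in_def)
  finally show "vec_times R d x (mat_plus R d a b) $ j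
      = vec d (\<lambda>j. vec_times R d x a $ j \<oplus> vec_times R d x b $ j) $ j"
    using j by (simp add: vec_times_def)
qed (simp add: vec_times_def)

lemma (in cring) mat_plus_minus_cancel:
  assumes "a \<in> gl_mat d R" "b \<in> gl_mat d R"
  shows "mat_plus R d b (mat_minus R d a b) = a"
proof (rule eq_matI)
  fix i j assume "i < dim_row a" "j < dim_col a"
  then have ij: "i < d" "j < d" using assms by (auto simp: gl_mat_def)
  then have c: "a $$ (i, j) \<in> carrier R" "b $$ (i, j) \<in> carrier R"
    using assms by (auto simp: gl_mat_iff)
  then have "b $$ (i, j) \<oplus> (a $$ (i, j) \<ominus> b $$ (i, j)) = a $$ (i, j)" by algebra
  then show "mat_plus R d b (mat_minus R d a b) $$ (i, j) = a $$ (i, j)"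
    using ij by (simp add: mat_plus_def mat_minus_def)
qed (use assms in \<open>auto simp: mat_plus_def gl_mat_def\<close>)

text \<open>This is \<open>|M| = |im| |ker|\<close> for the additive map \<open>a \<mapsto> xa\<close>: translation by a matrix \<open>b\<close> carries
  the kernel bijectively onto the fibre over \<open>xb\<close>.\<close>

lemma (in cring) card_mats_eq_image_times_kernel:
  assumes M: "M \<subseteq> gl_mat d R" and fin: "finite M"
    and plus: "\<And>a b. \<lbrakk>a \<in> M; b \<in> M\<rbrakk> \<Longrightarrow> mat_plus R d a b \<in> M"
    and minus: "\<And>a b. \<lbrakk>a \<in> M; b \<in> M\<rbrakk> \<Longrightarrow> mat_minus R d a b \<in> M"
    and x: "x \<in> vecs_in d (carrier R)"
  shows "card M = card (vec_times R d x ` M) * card {a \<in> M. vec_times R d x a = zero_vec_in R d}"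
proof -
  let ?f = "vec_times R d x"
  let ?N = "{a \<in> M. ?f a = zero_vec_in R d}"
  have entry: "?f a $ j \<in> carrier R" if "a \<in> M" "j < d" for a j
    using vec_times_closed[of a d x] that M x by (auto simp: vecs_in_def)
  have dimf: "?f a \<in> carrier_vec d" for a by (simp add: vec_times_def)
  have fibre: "card {a \<in> M. ?f a = w} = card ?N" if w: "w \<in> ?f ` M" for w
  proof -
    obtain b where b: "b \<in> M" "w = ?f b" using w by auto
    have "bij_betw (mat_plus R d b) ?N {a \<in> M. ?f a = w}"
      unfolding bij_betw_def
    proof
      show "inj_on (mat_plus R d b) ?N"
      proof (rule inj_onI)
        fix a c assume ac: "a \<in> ?N" "c \<in> ?N" and eq: "mat_plus R d b a = mat_plus R d b c"
        have g: "a \<in> gl_mat d R" "c \<in> gl_mat d R" "b \<in> gl_mat d R" using ac b M by auto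
        show "a = c"
        proof (rule eq_matI)
          fix i j assume "i < dim_row c" "j < dim_col c"
          then have ij: "i < d" "j < d" using g by (auto simp: gl_mat_def)
          have "b $$ (i, j) \<oplus> a $$ (i, j) = b $$ (i, j) \<oplus> c $$ (i, j)"
            using arg_cong[OF eq, of "\<lambda>m. m $$ (i, j)"] ij by (simp add: mat_plus_def)
          then show "a $$ (i, j) = c $$ (i, j)" using g ij by (simp add: gl_mat_iff)
        qed (use g in \<open>auto simp: gl_mat_def\<close>)
      qed
      show "mat_plus R d b ` ?N = {a \<in> M. ?f a = w}"
      proof (intro equalityI subsetI)
        fix c assume "c \<in> mat_plus R d b ` ?N"
        then obtain a where a: "a \<in> ?N" "c = mat_plus R d b a" by auto
        have "?f c = vec d (\<lambda>j. ?f b $ j \<oplus> ?f a $ j)"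
          unfolding a using a b M x by (intro vec_times_plus) auto
        also have "\<dots> = ?f b"
          using a b entry[OF b(1)] dimf[of b] by (intro eq_vecI) (auto simp: zero_vec_in_def)
        finally show "c \<in> {a \<in> M. ?f a = w}" using a b plus by auto
      next
        fix a assume a: "a \<in> {a \<in> M. ?f a = w}"
        define c where "c = mat_minus R d a b"
        have c: "c \<in> M" using a b minus by (simp add: c_def)
        have ac: "mat_plus R d b c = a"
          unfolding c_def using a b M by (intro mat_plus_minus_cancel) auto
        have eq: "?f a = vec d (\<lambda>j. ?f b $ j \<oplus> ?f c $ j)"
          using vec_times_plus[of b d c x] M b c x unfolding ac by auto
        have "?f c = zero_vec_in R d"
        proof (rule eq_vecI)
          fix j assume "j < dim_vec (zero_vec_in R d)"
          then have j: "j < d" by (simp add: zero_vec_in_def)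
          have "?f b $ j = ?f b $ j \<oplus> ?f c $ j"
            using arg_cong[OF eq, of "\<lambda>y. y $ j"] a b j by simp
          then have "?f c $ j = \<zero>" using entry[OF b(1) j] entry[OF c j] by simp
          then show "?f c $ j = zero_vec_in R d $ j" using j by (simp add: zero_vec_in_def)
        qed (simp add: vec_times_def zero_vec_in_def)
        then show "a \<in> mat_plus R d b ` ?N" using c ac by (intro image_eqI[of _ _ c]) auto
      qed
    qed
    from bij_betw_same_card[OF this] show ?thesis by simp
  qed
  have "card M = (\<Sum>w \<in> ?f ` M. card {a \<in> M. ?f a = w})"
    using sum.image_gen[OF fin, of "\<lambda>_. 1::nat" ?f] by (simp only: card_eq_sum)
  also have "\<dots> = card (?f ` M) * card ?N" using fibre by simp
  finally show ?thesis .
qed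

section \<open>The average kernel size of a transitive module of matrices\<close>

text \<open>The step that makes symmetric matrices behave like arbitrary ones. If \<open>y\<^sub>i\<close> is a unit, it
  suffices to use symmetric matrices supported in row and column \<open>i\<close>. Let \<open>c\<close> be that row. For \<open>j \<noteq> i\<close>
  the \<open>j\<close>-th coordinate of \<open>ya\<close> is \<open>y\<^sub>i c\<^sub>j\<close>, which determines \<open>c\<^sub>j\<close>; the \<open>i\<close>-th coordinate is
  \<open>y\<^sub>i c\<^sub>i\<close> plus the sum of the \<open>y\<^sub>j c\<^sub>j\<close> already chosen, and can be solved for \<open>c\<^sub>i\<close>.\<close>

lemma (in cring) Sym_mat_transitive:
  assumes y: "y \<in> vecs_in d (carrier R)" and i: "i < d" and u: "y $ i \<in> Units R"
    and z: "z \<in> vecs_in d (carrier R)"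
  shows "\<exists>a \<in> Sym_mat d R. vec_times R d y a = z"
proof -
  have yc: "y $ j \<in> carrier R" and zc: "z $ j \<in> carrier R" if "j < d" for j
    using y z that by (auto simp: vecs_in_def)
  have unit_cancel: "y $ i \<otimes> (inv (y $ i) \<otimes> w) = w" if "w \<in> carrier R" for w
    using u that by (metis Units_closed Units_inv_closed Units_r_inv l_one m_assoc)
  define b where "b j = inv (y $ i) \<otimes> z $ j" for j
  have b: "b j \<in> carrier R" if "j < d" for j using u zc[OF that] by (simp add: b_def)
  define r where "r = (\<Oplus>j \<in> {..<d} - {i}. y $ j \<otimes> b j)"
  have r: "r \<in> carrier R" unfolding r_def using yc b by (intro finsum_closed) auto
  define c where "c j = (if j = i then inv (y $ i) \<otimes> (z $ i \<ominus> r) else b j)" for j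
  have c: "c j \<in> carrier R" if "j < d" for j using u zc[OF i] b[OF that] r by (simp add: c_def)
  define a where "a = mat d d (\<lambda>(k, l). if k = i then c l else if l = i then c k else \<zero>)"
  have ac: "a $$ (k, l) \<in> carrier R" if "k < d" "l < d" for k l
    using that c by (simp add: a_def)
  have "a \<in> gl_mat d R" unfolding gl_mat_iff using ac by (simp add: a_def)
  then have "a \<in> Sym_mat d R" unfolding Sym_mat_iff by (auto simp: a_def)
  moreover have "vec_times R d y a = z"
  proof (rule eq_vecI)
    show "dim_vec (vec_times R d y a) = dim_vec z" using z by (auto simp: vec_times_def vecs_in_def)
    fix l assume "l < dim_vec z"
    then have l: "l < d" using z by (auto simp: vecs_in_def)
    have "(\<Oplus>k \<in> {..<d}. y $ k \<otimes> a $$ (k, l)) = (\<Oplus>k \<in> insert i ({..<d} - {i}). y $ k \<otimes> a $$ (k, l))"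
      using i by (simp add: insert_absorb)
    also have "\<dots> = y $ i \<otimes> a $$ (i, l) \<oplus> (\<Oplus>k \<in> {..<d} - {i}. y $ k \<otimes> a $$ (k, l))"
      using i l yc ac by (subst finsum_insert) auto
    also have "\<dots> = z $ l"
    proof (cases "l = i")
      case True
      have "(\<Oplus>k \<in> {..<d} - {i}. y $ k \<otimes> a $$ (k, l)) = r"
        unfolding r_def True using i yc b by (intro finsum_cong') (auto simp: a_def c_def)
      moreover have "y $ i \<otimes> a $$ (i, l) = z $ i \<ominus> r"
        using unit_cancel[OF minus_closed[OF zc[OF i] r]] i True by (simp add: a_def c_def)
      moreover have "z $ i \<ominus> r \<oplus> r = z $ i" using zc[OF i] r by algebra
      ultimately show ?thesis using True by simp
    next
      case False
      have "(\<Oplus>k \<in> {..<d} - {i}. y $ k \<otimes> a $$ (k, l)) = (\<Oplus>k \<in> {..<d} - {i}. \<zero>)"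
        using False l yc by (intro finsum_cong') (auto simp: a_def)
      moreover have "y $ i \<otimes> a $$ (i, l) = z $ l"
        using unit_cancel[OF zc[OF l]] i l False by (simp add: a_def c_def b_def)
      ultimately show ?thesis using zc[OF l] by simp
    qed
    finally show "vec_times R d y a $ l = z $ l" using l by (simp add: vec_times_def)
  qed
  ultimately show ?thesis by blast
qed

text \<open>An additive group \<open>M\<close> of matrices that moves every vector with a unit coordinate onto all of
  \<open>S\<^sup>d\<close>. These properties are shared by all matrices and by symmetric matrices, and they determine the
  average kernel size.\<close>

locale transitive_mats = finite_chain_ring +
  fixes d :: nat and M :: "'a mat set"
  assumes M_subset: "M \<subseteq> gl_mat d S"
    and M_nonempty: "M \<noteq> {}"
    and M_plus: "\<lbrakk>a \<in> M; b \<in> M\<rbrakk> \<Longrightarrow> mat_plus S d a b \<in> M"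
    and M_minus: "\<lbrakk>a \<in> M; b \<in> M\<rbrakk> \<Longrightarrow> mat_minus S d a b \<in> M"
    and M_transitive: "\<lbrakk>y \<in> vecs_in d (carrier S); i < d; y $ i \<in> Units S; z \<in> vecs_in d (carrier S)\<rbrakk>
      \<Longrightarrow> \<exists>a \<in> M. vec_times S d y a = z"
begin

definition level_vecs :: "nat \<Rightarrow> 'a vec set" where
  "level_vecs k = vecs_in d (pow_ideal k)"

definition annihilator :: "'a vec \<Rightarrow> 'a mat set" where
  "annihilator x = {a \<in> M. vec_times S d x a = zero_vec_in S d}"

lemma finite_mats: "finite M"
  using finite_subset[OF M_subset finite_gl_mat[OF finite_carrier]] .

lemma level_vecs_0: "level_vecs 0 = vecs_in d (carrier S)"
  by (simp add: level_vecs_def pow_ideal_0)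

lemma level_vecs_subset: "level_vecs k \<subseteq> vecs_in d (carrier S)"
  using pow_ideal_subset by (auto simp: level_vecs_def vecs_in_def)

lemma level_vecs_Suc_subset: "level_vecs (Suc k) \<subseteq> level_vecs k"
  using pow_ideal_Suc_subset by (auto simp: level_vecs_def vecs_in_def)

lemma finite_level_vecs: "finite (level_vecs k)"
  unfolding level_vecs_def by (rule finite_vecs_in[OF finite_pow_ideal])

lemma card_level_vecs_pos: "0 < card (level_vecs k)"
  using finite_pow_ideal[of k] zero_pow_ideal[of k]
  by (auto simp: level_vecs_def card_vecs_in card_gt_0_iff)

lemma card_level_vecs: "k < n \<Longrightarrow> card (level_vecs k) = card D ^ d * card (level_vecs (Suc k))"
  by (simp add: level_vecs_def card_vecs_in card_pow_ideal power_mult_distrib)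

lemma level_vecs_n: "level_vecs n = {zero_vec_in S d}"
  by (auto simp: level_vecs_def vecs_in_def pow_ideal_n zero_vec_in_def intro!: eq_vecI)

text \<open>A vector at level exactly \<open>k\<close> is \<open>p\<^sup>k y\<close> where \<open>y\<close> has a unit coordinate, for otherwise another
  factor \<open>p\<close> could be extracted. Hence its image under \<open>M\<close> is \<open>p\<^sup>k\<close> times the whole of \<open>S\<^sup>d\<close>.\<close>

lemma image_vec_times:
  assumes x: "x \<in> level_vecs k" "x \<notin> level_vecs (Suc k)"
  shows "vec_times S d x ` M = level_vecs k"
proof -
  have "\<forall>j \<in> {..<d}. \<exists>s \<in> carrier S. x $ j = p [^] k \<otimes> s"
    using x(1) by (auto simp: level_vecs_def vecs_in_def pow_ideal_def)
  then obtain s where s: "\<And>j. j < d \<Longrightarrow> s j \<in> carrier S" "\<And>j. j < d \<Longrightarrow> x $ j = p [^] k \<otimes> s j"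
    by (metis lessThan_iff)
  define y where "y = vec d s"
  have y: "y \<in> vecs_in d (carrier S)" using s(1) by (simp add: y_def vecs_in_def)
  have scale: "vec_times S d x a $ j = p [^] k \<otimes> vec_times S d y a $ j"
    if a: "a \<in> M" and j: "j < d" for a j
  proof -
    have ac: "a $$ (i, j) \<in> carrier S" if "i < d" for i
      using M_subset a j that by (auto simp: gl_mat_iff)
    have "(\<Oplus>i \<in> {..<d}. x $ i \<otimes> a $$ (i, j)) = (\<Oplus>i \<in> {..<d}. p [^] k \<otimes> (y $ i \<otimes> a $$ (i, j)))"
      using s ac by (intro finsum_cong') (auto simp: y_def m_assoc)
    also have "\<dots> = p [^] k \<otimes> (\<Oplus>i \<in> {..<d}. y $ i \<otimes> a $$ (i, j))"
      using s ac by (intro finsum_rdistr[symmetric]) (auto simp: y_def)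
    finally show ?thesis using j by (simp add: vec_times_def)
  qed
  have "\<exists>i<d. s i \<in> Units S"
  proof (rule ccontr)
    assume non: "\<not> (\<exists>i<d. s i \<in> Units S)"
    have "x $ j \<in> pow_ideal (Suc k)" if j: "j < d" for j
    proof -
      obtain t where t: "t \<in> carrier S" "s j = p \<otimes> t"
        using nonunit_dvd[OF s(1)[OF j]] non j by auto
      then have "x $ j = p [^] Suc k \<otimes> t" using s(2)[OF j] by (simp add: m_assoc)
      then show ?thesis using t(1) by (auto simp: pow_ideal_def)
    qed
    then have "x \<in> level_vecs (Suc k)" using x(1) by (auto simp: level_vecs_def vecs_in_def)
    with x(2) show False by simp
  qed
  then obtain i where i: "i < d" "y $ i \<in> Units S" by (auto simp: y_def)
  show ?thesis
  proof (intro equalityI subsetI)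
    fix w assume "w \<in> vec_times S d x ` M"
    then obtain a where a: "a \<in> M" "w = vec_times S d x a" by auto
    have "vec_times S d y a \<in> vecs_in d (carrier S)"
      using vec_times_closed[of a d y] M_subset a y by auto
    then have "w $ j \<in> pow_ideal k" if "j < d" for j
      using scale[OF a(1) that] a(2) that by (auto simp: pow_ideal_def vecs_in_def)
    then show "w \<in> level_vecs k" using a by (auto simp: level_vecs_def vecs_in_def vec_times_def)
  next
    fix w assume w: "w \<in> level_vecs k"
    have wd: "dim_vec w = d" using w by (auto simp: level_vecs_def vecs_in_def)
    have "\<forall>j \<in> {..<d}. \<exists>t \<in> carrier S. w $ j = p [^] k \<otimes> t"
      using w by (auto simp: level_vecs_def vecs_in_def pow_ideal_def)
    then obtain t where t: "\<And>j. j < d \<Longrightarrow> t j \<in> carrier S" "\<And>j. j < d \<Longrightarrow> w $ j = p [^] k \<otimes> t j"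
      by (metis lessThan_iff)
    have "vec d t \<in> vecs_in d (carrier S)" using t(1) by (simp add: vecs_in_def)
    then obtain a where a: "a \<in> M" "vec_times S d y a = vec d t"
      using M_transitive[OF y i] by blast
    have "vec_times S d x a = w"
    proof (rule eq_vecI)
      fix j assume "j < dim_vec w"
      then have "j < d" using wd by simp
      then show "vec_times S d x a $ j = w $ j" using scale[OF a(1)] t(2) a(2) by simp
    qed (use wd in \<open>simp add: vec_times_def\<close>)
    then show "w \<in> vec_times S d x ` M" using a(1) by blast
  qed
qed

lemma card_annihilator:
  assumes x: "x \<in> level_vecs k" "x \<notin> level_vecs (Suc k)"
  shows "card M = card (level_vecs k) * card (annihilator x)"
  unfolding annihilator_def image_vec_times[OF x, symmetric]
  using x level_vecs_subset by (intro card_mats_eq_image_times_kernel M_subset finite_mats M_plus M_minus) auto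

lemma annihilator_zero: "annihilator (zero_vec_in S d) = M"
proof -
  have "vec_times S d (zero_vec_in S d) a = zero_vec_in S d" if a: "a \<in> M" for a
  proof (rule eq_vecI)
    fix j assume "j < dim_vec (zero_vec_in S d)"
    then have j: "j < d" by (simp add: zero_vec_in_def)
    have "(\<Oplus>i \<in> {..<d}. zero_vec_in S d $ i \<otimes> a $$ (i, j)) = (\<Oplus>i \<in> {..<d}. \<zero>)"
      using M_subset a j by (intro finsum_cong') (auto simp: zero_vec_in_def gl_mat_iff)
    then show "vec_times S d (zero_vec_in S d) a $ j = zero_vec_in S d $ j"
      using j by (simp add: vec_times_def zero_vec_in_def)
  qed (simp add: vec_times_def zero_vec_in_def)
  then show ?thesis by (auto simp: annihilator_def)
qed

text \<open>Write \<open>N\<^sub>k\<close> for the number of vectors divisible by \<open>p\<^sup>k\<close>. There are \<open>N\<^sub>k - N\<^sub>k\<^sub>+\<^sub>1\<close> vectors of level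
  exactly \<open>k\<close>, each killed by \<open>|M| / N\<^sub>k\<close> matrices. Their joint contribution
  \<open>|M| (1 - N\<^sub>k\<^sub>+\<^sub>1 / N\<^sub>k)\<close> does not depend on \<open>k\<close>, so descending induction adds the same amount
  at each of the levels below \<open>n\<close>; the zero vector contributes \<open>|M|\<close>.\<close>

lemma sum_annihilators:
  assumes "k \<le> n"
  shows "(\<Sum>x \<in> level_vecs k. of_nat (card (annihilator x)))
    = (of_nat (card M) :: rat) * (1 + of_nat (n - k) * (1 - 1 / of_nat (card D) ^ d))"
  using assms
proof (induction k rule: inc_induct)
  case base
  show ?case by (simp add: level_vecs_n annihilator_zero)
next
  case (step k)
  let ?c = "\<lambda>x. of_nat (card (annihilator x)) :: rat"
  let ?N = "\<lambda>k. of_nat (card (level_vecs k)) :: rat"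
  have N: "?N k = of_nat (card D) ^ d * ?N (Suc k)" using card_level_vecs[of k] step.hyps by simp
  have pos: "?N k \<noteq> 0" "?N (Suc k) \<noteq> 0" using card_level_vecs_pos by simp_all
  have "(\<Sum>x \<in> level_vecs k. ?c x) = (\<Sum>x \<in> level_vecs (Suc k). ?c x) + (\<Sum>x \<in> level_vecs k - level_vecs (Suc k). ?c x)"
    using sum.subset_diff[OF level_vecs_Suc_subset finite_level_vecs, of ?c k] by simp
  also have "(\<Sum>x \<in> level_vecs k - level_vecs (Suc k). ?c x) = (\<Sum>x \<in> level_vecs k - level_vecs (Suc k). of_nat (card M) / ?N k)"
  proof (rule sum.cong[OF refl])
    fix x assume "x \<in> level_vecs k - level_vecs (Suc k)"
    then have "card M = card (level_vecs k) * card (annihilator x)" using card_annihilator by auto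
    then show "?c x = of_nat (card M) / ?N k" using pos by (simp add: field_simps)
  qed
  also have "\<dots> = (?N k - ?N (Suc k)) * (of_nat (card M) / ?N k)"
    using card_Diff_subset[OF finite_level_vecs level_vecs_Suc_subset, of k] card_mono[OF finite_level_vecs level_vecs_Suc_subset, of k]
    by (simp add: of_nat_diff)
  also have "\<dots> = of_nat (card M) * (1 - 1 / of_nat (card D) ^ d)"
  proof -
    have "(?N k - ?N (Suc k)) / ?N k = 1 - ?N (Suc k) / ?N k"
      using pos by (simp add: diff_divide_distrib)
    also have "?N (Suc k) / ?N k = 1 / of_nat (card D) ^ d"
      unfolding N using pos by simp
    finally have "(?N k - ?N (Suc k)) / ?N k = 1 - 1 / of_nat (card D) ^ d" .
    then show ?thesis by (metis mult.commute times_divide_eq_right)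
  qed
  also have "(\<Sum>x \<in> level_vecs (Suc k). ?c x) + of_nat (card M) * (1 - 1 / of_nat (card D) ^ d)
      = of_nat (card M) * (1 + (1 + of_nat (n - Suc k)) * (1 - 1 / of_nat (card D) ^ d))"
    unfolding step.IH by (simp only: distrib_left distrib_right mult_1_left mult_1_right ac_simps)
  also have "1 + of_nat (n - Suc k) = (of_nat (n - k) :: rat)"
    using step.hyps by (simp only: Suc_diff_Suc[symmetric] of_nat_Suc)
  finally show ?case .
qed

text \<open>Counting the pairs \<open>(x, a)\<close> with \<open>xa = 0\<close> by \<open>x\<close> instead of by \<open>a\<close> reduces the average to
  the sum over all vectors, that is, from level \<open>0\<close> upwards.\<close>

lemma average_kernel:
  "(\<Sum>a \<in> M. of_nat (card (ker_mat S a))) / of_nat (card M)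
    = (1 + of_nat n * (1 - 1 / of_nat (card D) ^ d) :: rat)"
proof -
  let ?Q = "\<lambda>x a. vec_times S d x a = zero_vec_in S d"
  have "(\<Sum>a \<in> M. card (ker_mat S a)) = (\<Sum>a \<in> M. card {x \<in> level_vecs 0. ?Q x a})"
    using M_subset by (intro sum.cong refl) (auto simp: ker_mat_eq level_vecs_0)
  also have "\<dots> = (\<Sum>x \<in> level_vecs 0. card (annihilator x))"
    unfolding annihilator_def by (rule sum_multicount_gen) (simp_all add: finite_mats finite_level_vecs)
  finally have "(\<Sum>a \<in> M. card (ker_mat S a)) = (\<Sum>x \<in> level_vecs 0. card (annihilator x))" .
  then have "(\<Sum>a \<in> M. of_nat (card (ker_mat S a))) = (\<Sum>x \<in> level_vecs 0. of_nat (card (annihilator x)) :: rat)"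
    by (metis of_nat_sum)
  moreover have "card M \<noteq> 0" using finite_mats M_nonempty by simp
  ultimately show ?thesis using sum_annihilators[of 0] by simp
qed

end

context finite_chain_ring
begin

lemma zero_mat_in_Sym: "mat d d (\<lambda>_. \<zero>) \<in> Sym_mat d S"
  by (auto simp: Sym_mat_iff gl_mat_iff)

lemma transitive_mats_Sym: "transitive_mats S p n D d (Sym_mat d S)"
proof unfold_locales
  show "Sym_mat d S \<subseteq> gl_mat d S" by (auto simp: Sym_mat_def)
  show "Sym_mat d S \<noteq> {}" using zero_mat_in_Sym by blast
  show "mat_plus S d a b \<in> Sym_mat d S" "mat_minus S d a b \<in> Sym_mat d S"
    if "a \<in> Sym_mat d S" "b \<in> Sym_mat d S" for a b
    using that by (simp_all add: Sym_mat_iff gl_mat_iff mat_plus_def mat_minus_def)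
qed (rule Sym_mat_transitive)

lemma transitive_mats_gl: "transitive_mats S p n D d (gl_mat d S)"
proof unfold_locales
  show "gl_mat d S \<noteq> {}" using zero_mat_in_Sym by (auto simp: Sym_mat_def)
  show "mat_plus S d a b \<in> gl_mat d S" "mat_minus S d a b \<in> gl_mat d S"
    if "a \<in> gl_mat d S" "b \<in> gl_mat d S" for a b
    using that by (simp_all add: gl_mat_iff mat_plus_def mat_minus_def)
  show "\<exists>a \<in> gl_mat d S. vec_times S d y a = z"
    if "y \<in> vecs_in d (carrier S)" "i < d" "y $ i \<in> Units S" "z \<in> vecs_in d (carrier S)" for y i z
    using Sym_mat_transitive[OF that] by (auto simp: Sym_mat_def)
qed simp

end

section \<open>The valuation ring of a local field\<close>

lemma (in cring) ideal_prod_cgenideal: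
  assumes a: "a \<in> carrier R" and b: "b \<in> carrier R"
  shows "ideal_prod R (PIdl a) (PIdl b) = PIdl (a \<otimes> b)"
proof (intro equalityI subsetI)
  have id: "ideal (PIdl (a \<otimes> b)) R" using a b by (intro cgenideal_ideal) simp
  fix x assume "x \<in> ideal_prod R (PIdl a) (PIdl b)"
  then show "x \<in> PIdl (a \<otimes> b)"
  proof (induction rule: ideal_prod.induct)
    case (prod i j)
    obtain s where s: "s \<in> carrier R" "i = s \<otimes> a"
      using prod(1) unfolding cgenideal_def by blast
    obtain t where t: "t \<in> carrier R" "j = t \<otimes> b"
      using prod(2) unfolding cgenideal_def by blast
    have "i \<otimes> j = (s \<otimes> t) \<otimes> (a \<otimes> b)"
      unfolding s(2) t(2) using s(1) t(1) a b by (simp add: m_ac)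
    moreover have "s \<otimes> t \<in> carrier R" using s(1) t(1) by (rule m_closed)
    ultimately show ?case unfolding cgenideal_def by blast
  next
    case (sum y z)
    show ?case by (rule additive_subgroup.a_closed[OF ideal.axioms(1)[OF id] sum.IH])
  qed
next
  fix x assume "x \<in> PIdl (a \<otimes> b)"
  then obtain s where s: "s \<in> carrier R" "x = s \<otimes> (a \<otimes> b)" unfolding cgenideal_def by blast
  have "x = (s \<otimes> a) \<otimes> b" unfolding s(2) using s(1) a b by (simp add: m_assoc)
  moreover have "s \<otimes> a \<in> PIdl a" using s unfolding cgenideal_def by blast
  ultimately show "x \<in> ideal_prod R (PIdl a) (PIdl b)"
    using ideal_prod.prod[OF _ cgenideal_self[OF b]] by simp
qed

lemma (in cring) ideal_pow_cgenideal:
  assumes "a \<in> carrier R"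
  shows "ideal_pow R (PIdl a) n = PIdl (a [^] n)"
proof (induction n)
  case 0
  have "PIdl \<one> = carrier R" using oneideal ideal.one_imp_carrier[OF cgenideal_ideal] cgenideal_self by simp
  then show ?case by (simp add: ideal_pow_def ideals_set_def)
next
  case (Suc n)
  then show ?case
    using ideal_prod_cgenideal[of "a [^] n" a] assms by (simp add: ideal_pow_def ideals_set_def)
qed

context nonarch_abs
begin

lemma abs_minus_le:
  "\<lbrakk>x \<in> carrier K; y \<in> carrier K\<rbrakk> \<Longrightarrow> v (x \<ominus> y) \<le> max (v x) (v y)"
  using abs_ultrametric[of x "\<ominus> y"] by (simp add: minus_eq abs_uminus)

lemma abs_nat_pow: "x \<in> carrier K \<Longrightarrow> v (x [^] (k :: nat)) = v x ^ k"
  by (induction k) (simp_all add: abs_one abs_mult)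

lemma abs_pos: "\<lbrakk>x \<in> carrier K; x \<noteq> \<zero>\<rbrakk> \<Longrightarrow> 0 < v x"
  using abs_nonneg[of x] abs_eq_0_iff[of x] by simp

lemma abs_zero: "v \<zero> = 0"
  by (simp add: abs_eq_0_iff)

lemma abs_inverse_facts:
  assumes "x \<in> carrier K" "x \<noteq> \<zero>"
  shows "inv x \<in> carrier K" "x \<otimes> inv x = \<one>" "inv x \<otimes> x = \<one>" "v (inv x) = inverse (v x)"
proof -
  have u: "x \<in> Units K" using assms by (simp add: field_Units)
  show "inv x \<in> carrier K" "x \<otimes> inv x = \<one>" "inv x \<otimes> x = \<one>" using u by simp_all
  then show "v (inv x) = inverse (v x)"
    using abs_mult[of "inv x" x] assms(1) abs_one by (metis inverse_unique mult.commute)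
qed

abbreviation \<O> :: "('a, 'b) ring_scheme" where
  "\<O> \<equiv> valuation_ring K v"

lemma carrier_\<O>: "x \<in> carrier \<O> \<longleftrightarrow> x \<in> carrier K \<and> v x \<le> 1"
  by (simp add: valuation_ring_def)

lemma valuation_ring_simps [simp]:
  "monoid.mult \<O> = monoid.mult K" "one \<O> = one K" "add \<O> = add K" "zero \<O> = zero K"
  by (simp_all add: valuation_ring_def)

lemma cring_valuation_ring: "cring \<O>"
proof -
  have "subring {x \<in> carrier K. v x \<le> 1} K"
  proof (rule subringI)
    fix x y assume "x \<in> {x \<in> carrier K. v x \<le> 1}" "y \<in> {x \<in> carrier K. v x \<le> 1}"
    then have xy: "x \<in> carrier K" "y \<in> carrier K" "v x \<le> 1" "v y \<le> 1" by auto
    show "x \<otimes> y \<in> {x \<in> carrier K. v x \<le> 1}"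
      using xy by (simp add: abs_mult mult_le_one abs_nonneg)
    show "x \<oplus> y \<in> {x \<in> carrier K. v x \<le> 1}"
      using xy abs_ultrametric[of x y] by auto
  qed (auto simp: abs_one abs_uminus)
  then have "subcring {x \<in> carrier K. v x \<le> 1} K" by (rule subcringI')
  then show ?thesis
    unfolding valuation_ring_def using subcring_iff[of "{x \<in> carrier K. v x \<le> 1}"] by auto
qed

lemma minus_valuation_ring:
  assumes "x \<in> carrier \<O>" "y \<in> carrier \<O>"
  shows "x \<ominus>\<^bsub>\<O>\<^esub> y = x \<ominus> y"
proof -
  interpret O: cring \<O> by (rule cring_valuation_ring)
  have z: "\<ominus>\<^bsub>\<O>\<^esub> y \<in> carrier K" "\<ominus>\<^bsub>\<O>\<^esub> y \<oplus> y = \<zero>"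
    using O.a_inv_closed[OF assms(2)] O.l_neg[OF assms(2)] by (simp_all add: carrier_\<O>)
  then have "\<ominus> y = \<ominus>\<^bsub>\<O>\<^esub> y"
    using minus_equality[of "\<ominus>\<^bsub>\<O>\<^esub> y" y] assms(2) by (simp add: carrier_\<O>)
  then show ?thesis by (simp add: minus_eq O.minus_eq)
qed

lemma nat_pow_valuation_ring: "x [^]\<^bsub>\<O>\<^esub> (k :: nat) = x [^] k"
  by (simp add: valuation_ring_def nat_pow_consistent[symmetric])

lemma Units_valuation_ring:
  assumes "x \<in> carrier K" "v x = 1"
  shows "x \<in> Units \<O>"
proof -
  have "x \<noteq> \<zero>" using assms abs_zero by auto
  note i = abs_inverse_facts[OF assms(1) this]
  then show ?thesis unfolding Units_def using assms by (auto simp: carrier_\<O>)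
qed

lemma cgenideal_valuation_ring:
  assumes a: "a \<in> carrier \<O>" "a \<noteq> \<zero>"
  shows "PIdl\<^bsub>\<O>\<^esub> a = {x \<in> carrier K. v x \<le> v a}"
proof (intro equalityI subsetI)
  have ac: "a \<in> carrier K" and pos: "0 < v a" using a abs_pos by (auto simp: carrier_\<O>)
  fix x
  {
    assume "x \<in> PIdl\<^bsub>\<O>\<^esub> a"
    then obtain s where s: "s \<in> carrier K" "v s \<le> 1" "x = s \<otimes> a"
      by (auto simp: cgenideal_def carrier_\<O>)
    then show "x \<in> {x \<in> carrier K. v x \<le> v a}"
      using ac pos by (simp add: abs_mult mult_le_cancel_right1)
  next
    assume "x \<in> {x \<in> carrier K. v x \<le> v a}"
    then have x: "x \<in> carrier K" "v x \<le> v a" by auto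
    note i = abs_inverse_facts[OF ac a(2)]
    have "x = (x \<otimes> inv a) \<otimes> a" using x ac i by (simp add: m_assoc)
    moreover have "x \<otimes> inv a \<in> carrier \<O>"
      using x i pos by (simp add: carrier_\<O> abs_mult divide_inverse[symmetric])
    ultimately show "x \<in> PIdl\<^bsub>\<O>\<^esub> a" by (auto simp: cgenideal_def)
  }
qed

end

context nonarch_local_field
begin

lemma ex_small: "\<exists>t \<in> carrier K. t \<noteq> \<zero> \<and> v t < 1"
proof -
  obtain x where x: "x \<in> carrier K" "x \<noteq> \<zero>" "v x \<noteq> 1" using abs_nontrivial by blast
  show ?thesis
  proof (cases "v x < 1")
    case False
    note i = abs_inverse_facts[OF x(1,2)]
    have "v (inv x) < 1" using False x(3) i(4) by (simp add: inverse_less_1_iff)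
    moreover have "inv x \<noteq> \<zero>" using i x by auto
    ultimately show ?thesis using i(1) by blast
  qed (use x in blast)
qed

text \<open>Local compactness at \<open>0\<close> makes a small ball \<open>cO\<close> totally bounded, and division by \<open>c\<close> transports
  this to the valuation ring \<open>O\<close> itself. Discreteness of the absolute value and finiteness of the
  quotients of \<open>O\<close> both come from this one fact.\<close>

lemma valuation_ring_totally_bounded:
  assumes e: "0 < e"
  shows "\<exists>F. finite F \<and> F \<subseteq> carrier \<O> \<and> (\<forall>x \<in> carrier \<O>. \<exists>f \<in> F. v (x \<ominus> f) < e)"
proof -
  interpret Metric_space "carrier K" "abs_dist K v" by (rule Metric_space_abs_dist)
  obtain U C where UC: "openin mtopology U" "compactin mtopology C" "\<zero> \<in> U" "U \<subseteq> C"
    using bspec[OF locally_compact[unfolded locally_compact_space_def], of \<zero>] by auto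
  then obtain r where r: "0 < r" "mball \<zero> r \<subseteq> U" unfolding openin_mtopology by blast
  obtain t where t: "t \<in> carrier K" "t \<noteq> \<zero>" "v t < 1" using ex_small by blast
  obtain m where m: "v t ^ m < r" using real_arch_pow_inv[OF r(1) t(3)] by blast
  define c where "c = t [^] m"
  have c: "c \<in> carrier K" "v c < r" "0 < v c"
    using t m abs_pos[of t] by (auto simp: c_def abs_nat_pow)
  have "(\<lambda>x. c \<otimes> x) ` carrier \<O> \<subseteq> mball \<zero> r"
  proof (rule image_subsetI)
    fix x assume "x \<in> carrier \<O>"
    then have x: "x \<in> carrier K" "v x \<le> 1" by (simp_all add: carrier_\<O>)
    have "v (c \<otimes> x) \<le> v c" using x c by (simp add: abs_mult mult_le_cancel_left1)
    moreover have "v (\<zero> \<ominus> c \<otimes> x) = v (c \<otimes> x)" using x c by (simp add: minus_eq abs_uminus)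
    ultimately show "c \<otimes> x \<in> mball \<zero> r" using x c by (simp add: abs_dist_def)
  qed
  then have "(\<lambda>x. c \<otimes> x) ` carrier \<O> \<subseteq> C" using r UC by blast
  then have "mtotally_bounded ((\<lambda>x. c \<otimes> x) ` carrier \<O>)"
    using compactin_imp_mtotally_bounded[OF UC(2)] mtotally_bounded_subset by blast
  moreover have "0 < e * v c" using e c by simp
  ultimately have "\<exists>F'. finite F' \<and> F' \<subseteq> (\<lambda>x. c \<otimes> x) ` carrier \<O>
      \<and> (\<lambda>x. c \<otimes> x) ` carrier \<O> \<subseteq> (\<Union>y \<in> F'. mball y (e * v c))"
    unfolding mtotally_bounded_def by simp
  then obtain F' where F': "finite F'" "F' \<subseteq> (\<lambda>x. c \<otimes> x) ` carrier \<O>"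
    "(\<lambda>x. c \<otimes> x) ` carrier \<O> \<subseteq> (\<Union>y \<in> F'. mball y (e * v c))"
    by (elim exE conjE) (rule that)
  obtain F where F: "F \<subseteq> carrier \<O>" "finite F" "F' = (\<lambda>x. c \<otimes> x) ` F"
    using finite_subset_image[OF F'(1,2)] by blast
  have "\<exists>f \<in> F. v (x \<ominus> f) < e" if x: "x \<in> carrier \<O>" for x
  proof -
    obtain f where f: "f \<in> F" "c \<otimes> x \<in> mball (c \<otimes> f) (e * v c)"
      using F'(3) x unfolding F(3) by blast
    have fx: "f \<in> carrier K" "x \<in> carrier K" using f(1) F(1) x by (auto simp: carrier_\<O>)
    have "c \<otimes> x \<ominus> c \<otimes> f = c \<otimes> (x \<ominus> f)" using fx c(1) by algebra
    then have "v c * v (x \<ominus> f) < e * v c"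
      using f(2) fx c(1) commute[of "c \<otimes> f" "c \<otimes> x"] by (simp add: abs_dist_def abs_mult)
    then show ?thesis using f(1) c(3) by (auto simp: mult.commute)
  qed
  then show ?thesis using F by blast
qed

text \<open>Approximating to within \<open>v t\<close>, for some \<open>t\<close> with \<open>0 < v t < 1\<close>, does not change an absolute
  value above \<open>v t\<close>, because \<open>v\<close> is ultrametric. So the absolute values between \<open>v t\<close> and
  \<open>1\<close> all occur on a finite net, and the ones below \<open>1\<close> have a maximum.\<close>

lemma ex_uniformizer:
  "\<exists>w \<in> carrier K. w \<noteq> \<zero> \<and> v w < 1 \<and> (\<forall>x \<in> carrier K. v x < 1 \<longrightarrow> v x \<le> v w)"
proof -
  obtain t where t: "t \<in> carrier K" "t \<noteq> \<zero>" "v t < 1" using ex_small by blast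
  obtain F where F: "finite F" "F \<subseteq> carrier \<O>" "\<And>x. x \<in> carrier \<O> \<Longrightarrow> \<exists>f \<in> F. v (x \<ominus> f) < v t"
    using valuation_ring_totally_bounded[OF abs_pos[OF t(1,2)]] by blast
  \<comment> \<open>Adding \<open>t\<close> keeps the set nonempty and covers the elements with absolute value at most \<open>v t\<close>.\<close>
  define A where "A = insert t {f \<in> F. v t \<le> v f \<and> v f < 1}"
  have A: "finite A" "A \<noteq> {}" using F(1) by (auto simp: A_def)
  have "Max (v ` A) \<in> v ` A" using A by (intro Max_in) auto
  then obtain w where w: "w \<in> A" "Max (v ` A) = v w" by blast
  have w_max: "v f \<le> v w" if "f \<in> A" for f
    unfolding w(2)[symmetric] using A that by (intro Max_ge) auto
  have wt: "v t \<le> v w" using w_max by (simp add: A_def)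
  have wc: "w \<in> carrier K" "v w < 1"
    using w(1) t F(2) by (auto simp: A_def carrier_\<O>)
  have "v x \<le> v w" if x: "x \<in> carrier K" "v x < 1" for x
  proof (cases "v x \<le> v t")
    case False
    obtain f where f: "f \<in> F" "v (x \<ominus> f) < v t" using F(3)[of x] x by (auto simp: carrier_\<O>)
    have fc: "f \<in> carrier K" using f F by (auto simp: carrier_\<O>)
    have "x = f \<oplus> (x \<ominus> f)" "f = x \<ominus> (x \<ominus> f)" using x fc by algebra+
    then have "v x \<le> max (v f) (v (x \<ominus> f))" "v f \<le> max (v x) (v (x \<ominus> f))"
      using abs_ultrametric[of f "x \<ominus> f"] abs_minus_le[of x "x \<ominus> f"] x fc by simp_all
    then have "v f = v x" using f(2) False by linarith
    moreover have "f \<in> A" using calculation f False x by (simp add: A_def)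
    ultimately show ?thesis using w_max by metis
  qed (use wt in simp)
  moreover have "w \<noteq> \<zero>" using wt abs_pos[OF t(1,2)] abs_zero by auto
  ultimately show ?thesis using wc by blast
qed

end

section \<open>Quotients of the valuation ring\<close>

lemma carrier_Quot: "carrier (R Quot I) = (\<lambda>x. I +>\<^bsub>R\<^esub> x) ` carrier R"
  by (auto simp: FactRing_simps)

context nonarch_abs
begin

lemma cgenideal_coset_eq_iff:
  assumes a: "a \<in> carrier \<O>" "a \<noteq> \<zero>" and xy: "x \<in> carrier \<O>" "y \<in> carrier \<O>"
  shows "PIdl\<^bsub>\<O>\<^esub> a +>\<^bsub>\<O>\<^esub> x = PIdl\<^bsub>\<O>\<^esub> a +>\<^bsub>\<O>\<^esub> y \<longleftrightarrow> v (x \<ominus> y) \<le> v a"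
proof -
  interpret O: cring \<O> by (rule cring_valuation_ring)
  have "x \<ominus> y \<in> carrier K" using xy by (simp add: carrier_\<O>)
  then show ?thesis
    using O.quotient_eq_iff_same_a_r_cos[OF O.cgenideal_ideal[OF a(1)] xy]
    by (simp add: minus_valuation_ring[OF xy] cgenideal_valuation_ring[OF a])
qed

end

text \<open>Since \<open>v w\<close> is the largest absolute value below \<open>1\<close>, the element \<open>w\<close> generates the
  maximal ideal.\<close>

locale uniformizer = nonarch_local_field +
  fixes w :: 'a
  assumes w_closed: "w \<in> carrier K" and w_nonzero: "w \<noteq> \<zero>" and w_less: "v w < 1"
    and w_max: "\<lbrakk>x \<in> carrier K; v x < 1\<rbrakk> \<Longrightarrow> v x \<le> v w"
begin

lemma w_pow: "w [^] (k :: nat) \<in> carrier \<O>" "w [^] k \<noteq> \<zero>" "v (w [^] k) = v w ^ k"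
proof -
  show *: "v (w [^] k) = v w ^ k" using w_closed by (rule abs_nat_pow)
  have "0 < v w" using abs_pos[OF w_closed w_nonzero] .
  then have "0 < v (w [^] k)" "v (w [^] k) \<le> 1" unfolding * using w_less by (simp_all add: power_le_one)
  then show "w [^] k \<in> carrier \<O>" "w [^] k \<noteq> \<zero>" using w_closed abs_zero by (auto simp: carrier_\<O>)
qed

lemma w_in: "w \<in> carrier \<O>" using w_closed w_less by (simp add: carrier_\<O>)

lemma ideal_pow_uniformizer: "ideal_pow \<O> (PIdl\<^bsub>\<O>\<^esub> w) n = PIdl\<^bsub>\<O>\<^esub> (w [^] n)"
  using cring.ideal_pow_cgenideal[OF cring_valuation_ring w_in]
  by (simp add: nat_pow_valuation_ring)

lemma less_one_factor:
  assumes "x \<in> carrier K" "v x < 1"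
  shows "\<exists>s \<in> carrier \<O>. x = w \<otimes> s"
proof -
  have "x \<in> PIdl\<^bsub>\<O>\<^esub> w"
    using assms w_max cgenideal_valuation_ring[OF w_in w_nonzero] by simp
  then obtain s where "s \<in> carrier \<O>" "x = s \<otimes> w" by (auto simp: cgenideal_def)
  moreover have "s \<otimes> w = w \<otimes> s" using calculation w_closed by (simp add: carrier_\<O> m_comm)
  ultimately show ?thesis by auto
qed

text \<open>A proper ideal contains no element of absolute value \<open>1\<close>, hence lies in the proper ideal
  generated by \<open>w\<close>; maximality gives equality.\<close>

lemma maximal_ideal_unique:
  assumes "maximalideal P \<O>"
  shows "P = PIdl\<^bsub>\<O>\<^esub> w"
proof -
  interpret O: cring \<O> by (rule cring_valuation_ring)
  interpret P: maximalideal P \<O> by fact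
  have eq: "PIdl\<^bsub>\<O>\<^esub> w = {x \<in> carrier K. v x \<le> v w}"
    by (rule cgenideal_valuation_ring[OF w_in w_nonzero])
  have "P \<subseteq> PIdl\<^bsub>\<O>\<^esub> w"
  proof
    fix x assume x: "x \<in> P"
    then have xO: "x \<in> carrier \<O>" by (rule P.Icarr)
    have "v x \<noteq> 1"
    proof
      assume "v x = 1"
      then have "x \<in> Units \<O>" using xO Units_valuation_ring by (simp add: carrier_\<O>)
      then obtain y where "y \<in> carrier \<O>" "x \<otimes> y = \<one>" unfolding Units_def by auto
      then have "\<one>\<^bsub>\<O>\<^esub> \<in> P" using P.I_r_closed[OF x] by fastforce
      then show False using P.one_imp_carrier P.I_notcarr by simp
    qed
    then show "x \<in> PIdl\<^bsub>\<O>\<^esub> w" unfolding eq using xO w_max by (simp add: carrier_\<O>)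
  qed
  moreover have "\<one> \<notin> PIdl\<^bsub>\<O>\<^esub> w" unfolding eq using w_less by (simp add: abs_one)
  then have "PIdl\<^bsub>\<O>\<^esub> w \<noteq> carrier \<O>" using O.one_closed by auto
  moreover have "PIdl\<^bsub>\<O>\<^esub> w \<subseteq> carrier \<O>" unfolding eq using w_less by (auto simp: carrier_\<O>)
  ultimately show ?thesis using P.I_maximal[OF O.cgenideal_ideal[OF w_in]] by auto
qed

text \<open>The quotient map \<open>h n\<close> identifies elements at distance at most \<open>(v w)\<^sup>n\<close>, so each axiom of a
  finite chain ring becomes a statement about \<open>v\<close>. Representatives \<open>F\<close> of the residue field stay
  distinct modulo \<open>w\<^sup>n\<close> when \<open>n\<close> is positive, but they all coincide in the zero ring; this is why
  the second claim has a hypothesis on \<open>n\<close>.\<close>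

lemma quotient_finite_chain_ring:
  assumes F: "F \<subseteq> carrier \<O>" and inj: "inj_on (\<lambda>x. PIdl\<^bsub>\<O>\<^esub> w +>\<^bsub>\<O>\<^esub> x) F"
    and reps: "carrier (\<O> Quot PIdl\<^bsub>\<O>\<^esub> w) = (\<lambda>x. PIdl\<^bsub>\<O>\<^esub> w +>\<^bsub>\<O>\<^esub> x) ` F"
  defines "h \<equiv> \<lambda>n x. ideal_pow \<O> (PIdl\<^bsub>\<O>\<^esub> w) n +>\<^bsub>\<O>\<^esub> x"
  shows "finite_chain_ring (quot_pow \<O> (PIdl\<^bsub>\<O>\<^esub> w) n) (h n w) n (h n ` F)"
    and "0 < n \<Longrightarrow> card (h n ` F) = card F"
proof -
  interpret O: cring \<O> by (rule cring_valuation_ring)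
  let ?I = "ideal_pow \<O> (PIdl\<^bsub>\<O>\<^esub> w) n"
  let ?S = "quot_pow \<O> (PIdl\<^bsub>\<O>\<^esub> w) n"
  have I: "ideal ?I \<O>" unfolding ideal_pow_uniformizer by (rule O.cgenideal_ideal[OF w_pow(1)])
  interpret Q: ring_hom_cring \<O> ?S "h n"
    unfolding quot_pow_def h_def by (rule ideal.rcos_ring_hom_cring[OF I cring_valuation_ring])
  have carr: "carrier ?S = h n ` carrier \<O>"
    unfolding quot_pow_def h_def by (rule carrier_Quot)
  have h_eq: "h n x = h n y \<longleftrightarrow> v (x \<ominus> y) \<le> v w ^ n" if "x \<in> carrier \<O>" "y \<in> carrier \<O>" for x y
    unfolding h_def ideal_pow_uniformizer
    using cgenideal_coset_eq_iff[OF w_pow(1,2) that] by (simp add: w_pow(3))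
  have h0: "h n \<zero> = \<zero>\<^bsub>?S\<^esub>" and h1: "h n \<one> = \<one>\<^bsub>?S\<^esub>" using Q.hom_zero Q.hom_one by simp_all
  have hm: "h n (x \<otimes> y) = h n x \<otimes>\<^bsub>?S\<^esub> h n y" and ha: "h n (x \<oplus> y) = h n x \<oplus>\<^bsub>?S\<^esub> h n y"
    if "x \<in> carrier \<O>" "y \<in> carrier \<O>" for x y using Q.hom_mult[OF that] Q.hom_add[OF that] by simp_all
  have cl: "x \<otimes> y \<in> carrier \<O>" "x \<oplus> y \<in> carrier \<O>" if "x \<in> carrier \<O>" "y \<in> carrier \<O>" for x y
    using O.m_closed[OF that] O.a_closed[OF that] by simp_all
  have K: "x \<in> carrier K" if "x \<in> carrier \<O>" for x using that by (simp add: carrier_\<O>)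
  have pow: "h n w [^]\<^bsub>?S\<^esub> k = h n (w [^] k)" for k :: nat
  proof (induction k)
    case (Suc k)
    then show ?case using hm[OF w_pow(1)[of k] w_in] by simp
  qed (simp add: h1)
  have pow_zero: "h n w [^]\<^bsub>?S\<^esub> k = \<zero>\<^bsub>?S\<^esub> \<longleftrightarrow> v w ^ k \<le> v w ^ n" for k :: nat
  proof -
    have "w [^] k \<ominus> \<zero> = w [^] k" using w_closed by (simp add: minus_eq)
    then show ?thesis
      unfolding pow h0[symmetric] using h_eq[OF w_pow(1) O.zero_closed] by (simp add: w_pow(3))
  qed
  have w_pos: "0 < v w" using abs_pos[OF w_closed w_nonzero] .
  have F_eq: "f = g" if fg: "f \<in> F" "g \<in> F" and "v (f \<ominus> g) < 1" for f g
  proof -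
    have O: "f \<in> carrier \<O>" "g \<in> carrier \<O>" using fg F by auto
    then have "v (f \<ominus> g) \<le> v w" using that w_max K by simp
    then show ?thesis
      using inj_onD[OF inj _ fg] cgenideal_coset_eq_iff[OF w_in w_nonzero O] by simp
  qed
  show "finite_chain_ring ?S (h n w) n (h n ` F)"
  proof unfold_locales
    obtain G where G: "finite G" "G \<subseteq> carrier \<O>" "\<And>x. x \<in> carrier \<O> \<Longrightarrow> \<exists>f \<in> G. v (x \<ominus> f) < v w ^ n"
      using valuation_ring_totally_bounded[of "v w ^ n"] w_pos by auto
    have "carrier ?S \<subseteq> h n ` G"
    proof
      fix X assume "X \<in> carrier ?S"
      then obtain x where x: "x \<in> carrier \<O>" "X = h n x" using carr by auto
      obtain f where "f \<in> G" "v (x \<ominus> f) < v w ^ n" using G(3)[OF x(1)] by blast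
      then show "X \<in> h n ` G" using h_eq[OF x(1), of f] G(2) x(2) by auto
    qed
    then show "finite (carrier ?S)" using G(1) finite_subset by blast
    show "h n w \<in> carrier ?S" using w_in carr by simp
    show "h n w [^]\<^bsub>?S\<^esub> n = \<zero>\<^bsub>?S\<^esub>" by (simp add: pow_zero)
    show "h n w [^]\<^bsub>?S\<^esub> k \<noteq> \<zero>\<^bsub>?S\<^esub>" if "k < n" for k
      using power_strict_decreasing[OF that w_pos w_less] by (simp add: pow_zero)
    show "\<exists>s \<in> carrier ?S. X = h n w \<otimes>\<^bsub>?S\<^esub> s" if X: "X \<in> carrier ?S" "X \<notin> Units ?S" for X
    proof -
      obtain x where x: "x \<in> carrier \<O>" "X = h n x" using X carr by auto
      have "v x \<noteq> 1"
      proof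
        assume "v x = 1"
        then have "x \<in> Units \<O>" using Units_valuation_ring K[OF x(1)] by simp
        then obtain y where y: "y \<in> carrier \<O>" "y \<otimes> x = \<one>" "x \<otimes> y = \<one>" unfolding Units_def by auto
        then have "h n y \<in> carrier ?S" "h n y \<otimes>\<^bsub>?S\<^esub> X = \<one>\<^bsub>?S\<^esub>" "X \<otimes>\<^bsub>?S\<^esub> h n y = \<one>\<^bsub>?S\<^esub>"
          using x hm[of x y] hm[of y x] h1 carr by auto
        then show False using X unfolding Units_def by auto
      qed
      then obtain s where "s \<in> carrier \<O>" "x = w \<otimes> s" using less_one_factor[of x] x by (auto simp: carrier_\<O>)
      then show ?thesis using hm[OF w_in] x carr by auto
    qed
    show "h n ` F \<subseteq> carrier ?S" using F carr by auto
    show "\<exists>f \<in> h n ` F. \<exists>s \<in> carrier ?S. X = f \<oplus>\<^bsub>?S\<^esub> h n w \<otimes>\<^bsub>?S\<^esub> s" if X: "X \<in> carrier ?S" for X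
    proof -
      obtain x where x: "x \<in> carrier \<O>" "X = h n x" using X carr by auto
      have "PIdl\<^bsub>\<O>\<^esub> w +>\<^bsub>\<O>\<^esub> x \<in> carrier (\<O> Quot PIdl\<^bsub>\<O>\<^esub> w)"
        using x(1) unfolding carrier_Quot by (rule imageI)
      then obtain f where f: "f \<in> F" "PIdl\<^bsub>\<O>\<^esub> w +>\<^bsub>\<O>\<^esub> x = PIdl\<^bsub>\<O>\<^esub> w +>\<^bsub>\<O>\<^esub> f"
        unfolding reps by blast
      have fO: "f \<in> carrier \<O>" using f F by auto
      have "v (x \<ominus> f) < 1"
        using f(2) cgenideal_coset_eq_iff[OF w_in w_nonzero x(1) fO] w_less by simp
      then obtain s where s: "s \<in> carrier \<O>" "x \<ominus> f = w \<otimes> s"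
        using less_one_factor[of "x \<ominus> f"] K[OF x(1)] K[OF fO] by auto
      have "x = f \<oplus> (x \<ominus> f)" using K[OF x(1)] K[OF fO] by algebra
      then have "X = h n f \<oplus>\<^bsub>?S\<^esub> h n w \<otimes>\<^bsub>?S\<^esub> h n s"
        unfolding x(2) s(2) using ha[OF fO cl(1)[OF w_in s(1)]] hm[OF w_in s(1)] by simp
      then show ?thesis using f(1) s(1) carr by blast
    qed
    show "f' = g'" if fg: "f' \<in> h n ` F" "g' \<in> h n ` F" and s': "s' \<in> carrier ?S"
      and eq: "f' = g' \<oplus>\<^bsub>?S\<^esub> h n w \<otimes>\<^bsub>?S\<^esub> s'" for f' g' s'
    proof -
      obtain f g s where fgs: "f \<in> F" "g \<in> F" "f' = h n f" "g' = h n g" "s \<in> carrier \<O>" "s' = h n s"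
        using fg s' carr by auto
      have O: "f \<in> carrier \<O>" "g \<in> carrier \<O>" using fgs F by auto
      note cK = K[OF O(1)] K[OF O(2)] K[OF fgs(5)]
      show ?thesis
      proof (cases "n = 0")
        case True
        have "v (f \<ominus> g) \<le> max (v f) (v g)" by (rule abs_minus_le[OF cK(1,2)])
        also have "\<dots> \<le> 1" using O by (simp add: carrier_\<O>)
        finally have "v (f \<ominus> g) \<le> 1" .
        then show ?thesis using h_eq[OF O] True fgs by simp
      next
        case False
        have ws: "w \<otimes> s \<in> carrier \<O>" by (rule cl(1)[OF w_in fgs(5)])
        have "h n f = h n (g \<oplus> w \<otimes> s)"
          using eq fgs ha[OF O(2) ws] hm[OF w_in fgs(5)] by simp
        then have "v (f \<ominus> (g \<oplus> w \<otimes> s)) \<le> v w ^ n" using h_eq[OF O(1) cl(2)[OF O(2) ws]] by simp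
        also have "\<dots> < 1" using w_pos w_less False by (simp add: power_less_one_iff)
        finally have 1: "v (f \<ominus> (g \<oplus> w \<otimes> s)) < 1" .
        have "v (w \<otimes> s) \<le> v w"
          using fgs(5) w_closed w_pos by (simp add: carrier_\<O> abs_mult mult_le_cancel_left1)
        then have 2: "v (w \<otimes> s) < 1" using w_less by simp
        have "f \<ominus> g = (f \<ominus> (g \<oplus> w \<otimes> s)) \<oplus> w \<otimes> s" using cK w_closed by algebra
        moreover have "f \<ominus> (g \<oplus> w \<otimes> s) \<in> carrier K" "w \<otimes> s \<in> carrier K" using cK w_closed by simp_all
        ultimately have "v (f \<ominus> g) < 1"
          using abs_ultrametric[of "f \<ominus> (g \<oplus> w \<otimes> s)" "w \<otimes> s"] 1 2 by simp
        then show ?thesis using F_eq fgs by auto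
      qed
    qed
  qed
  show "card (h n ` F) = card F" if n: "0 < n"
  proof (rule card_image, rule inj_onI)
    fix f g assume fg: "f \<in> F" "g \<in> F" "h n f = h n g"
    then have "v (f \<ominus> g) \<le> v w ^ n" using h_eq[of f g] F by auto
    also have "\<dots> < 1" using w_pos w_less n by (simp add: power_less_one_iff)
    finally show "f = g" using F_eq fg by auto
  qed
qed

end

section \<open>The zeta function\<close>

lemma reduce_gl_mat:
  assumes "carrier S = (\<lambda>x. ideal_pow R P n +>\<^bsub>R\<^esub> x) ` carrier R"
  shows "reduce_mats R P (gl_mat d R) n = gl_mat d S"
proof (intro equalityI subsetI)
  fix b assume "b \<in> reduce_mats R P (gl_mat d R) n"
  then show "b \<in> gl_mat d S" using assms by (auto simp: reduce_mats_def gl_mat_iff)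
next
  fix b assume b: "b \<in> gl_mat d S"
  define a where "a = map_mat (inv_into (carrier R) (\<lambda>x. ideal_pow R P n +>\<^bsub>R\<^esub> x)) b"
  have "a \<in> gl_mat d R" using b assms by (auto simp: a_def gl_mat_iff intro!: inv_into_into)
  moreover have "b = map_mat (\<lambda>x. ideal_pow R P n +>\<^bsub>R\<^esub> x) a"
    using b assms by (intro eq_matI) (auto simp: a_def gl_mat_iff f_inv_into_f)
  ultimately show "b \<in> reduce_mats R P (gl_mat d R) n" by (auto simp: reduce_mats_def)
qed

text \<open>A symmetric matrix over the quotient lifts to a symmetric one because one fixed choice of
  representatives is applied to all entries.\<close>

lemma reduce_Sym_mat:
  assumes "carrier S = (\<lambda>x. ideal_pow R P n +>\<^bsub>R\<^esub> x) ` carrier R"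
  shows "reduce_mats R P (Sym_mat d R) n = Sym_mat d S"
proof (intro equalityI subsetI)
  fix b assume "b \<in> reduce_mats R P (Sym_mat d R) n"
  then show "b \<in> Sym_mat d S" using assms by (auto simp: reduce_mats_def Sym_mat_iff gl_mat_iff)
next
  fix b assume b: "b \<in> Sym_mat d S"
  define a where "a = map_mat (inv_into (carrier R) (\<lambda>x. ideal_pow R P n +>\<^bsub>R\<^esub> x)) b"
  have "a \<in> Sym_mat d R" using b assms by (auto simp: a_def Sym_mat_iff gl_mat_iff intro!: inv_into_into)
  moreover have "b = map_mat (\<lambda>x. ideal_pow R P n +>\<^bsub>R\<^esub> x) a"
    using b assms by (intro eq_matI) (auto simp: a_def Sym_mat_iff gl_mat_iff f_inv_into_f)
  ultimately show "b \<in> reduce_mats R P (Sym_mat d R) n" by (auto simp: reduce_mats_def)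
qed

text \<open>One factor \<open>1 - X\<close> turns the arithmetic progression of coefficients into the sequence
  \<open>1, 1 - c, 1 - c, \<dots>\<close>, and the second one leaves \<open>1 - cX\<close>.\<close>

lemma fps_linear_coefficients:
  fixes c :: "'f :: field"
  shows "Abs_fps (\<lambda>n. 1 + of_nat n * (1 - c)) = (1 - fps_const c * fps_X) / (1 - fps_X)\<^sup>2"
proof -
  let ?F = "Abs_fps (\<lambda>n. 1 + of_nat n * (1 - c)) :: 'f fps"
  have G: "?F * (1 - fps_X) = Abs_fps (\<lambda>n. if n = 0 then 1 else 1 - c)"
    by (rule fps_ext) (auto simp: algebra_simps of_nat_diff)
  have "?F * (1 - fps_X)\<^sup>2 = Abs_fps (\<lambda>n. if n = 0 then 1 else 1 - c) * (1 - fps_X)"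
    by (simp add: power2_eq_square G mult.assoc[symmetric])
  also have "\<dots> = 1 - fps_const c * fps_X"
    by (rule fps_ext) (auto simp: algebra_simps)
  finally have "?F * (1 - fps_X)\<^sup>2 = 1 - fps_const c * fps_X" .
  moreover have "fps_nth (1 - fps_X :: 'f fps) 0 \<noteq> 0" by simp
  then have "(1 - fps_X)\<^sup>2 \<noteq> (0 :: 'f fps)" by (metis fps_zero_nth power_not_zero)
  ultimately show ?thesis by (metis nonzero_mult_div_cancel_right)
qed

theorem proposition5p13:
  fixes K :: "('a, 'b) ring_scheme" and v :: "'a \<Rightarrow> real"
    and R :: "('a, 'b) ring_scheme" and P :: "'a set" and q d :: nat
  assumes "nonarch_local_field K v"
    and "R = valuation_ring K v"
    and "maximalideal P R"
    and "q = card (carrier (R Quot P))"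
  shows "ask_zeta R P (Sym_mat d R) = ask_zeta R P (gl_mat d R)
    \<and> ask_zeta R P (gl_mat d R)
        = (1 - fps_const (1 / of_nat q ^ d) * fps_X) / (1 - fps_X)\<^sup>2"
proof -
  interpret nonarch_local_field K v by fact
  obtain w where w: "w \<in> carrier K" "w \<noteq> \<zero>\<^bsub>K\<^esub>" "v w < 1" "\<And>x. x \<in> carrier K \<Longrightarrow> v x < 1 \<Longrightarrow> v x \<le> v w"
    using ex_uniformizer by blast
  interpret uniformizer K v w by unfold_locales (use w in auto)
  have P: "P = PIdl\<^bsub>R\<^esub> w" using maximal_ideal_unique assms(2,3) by simp
  have "carrier (R Quot P) \<subseteq> (\<lambda>x. P +>\<^bsub>R\<^esub> x) ` carrier R" unfolding carrier_Quot ..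
  then obtain F where F: "F \<subseteq> carrier R" "inj_on (\<lambda>x. P +>\<^bsub>R\<^esub> x) F"
    "carrier (R Quot P) = (\<lambda>x. P +>\<^bsub>R\<^esub> x) ` F"
    unfolding subset_image_inj by blast
  have q: "q = card F" unfolding assms(4) F(3) by (rule card_image[OF F(2)])
  define h where "h n x = ideal_pow R P n +>\<^bsub>R\<^esub> x" for n x
  have chain: "finite_chain_ring (quot_pow R P n) (h n w) n (h n ` F)"
    and card_h: "0 < n \<Longrightarrow> card (h n ` F) = q" for n
    using quotient_finite_chain_ring[of F n] F unfolding h_def P assms(2) q by simp_all
  have carr: "carrier (quot_pow R P n) = (\<lambda>x. ideal_pow R P n +>\<^bsub>R\<^esub> x) ` carrier R" for n
    unfolding quot_pow_def by (rule carrier_Quot)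
  \<comment> \<open>For \<open>n = 0\<close> the reduced digit set is a singleton, but then the factor \<open>n\<close> hides its size.\<close>
  have count: "of_nat n * (1 - 1 / of_nat (card (h n ` F)) ^ d) = (of_nat n * (1 - 1 / of_nat q ^ d) :: rat)" for n
    using card_h[of n] by (cases "n = 0") auto
  let ?A = "Abs_fps (\<lambda>n. 1 + of_nat n * (1 - 1 / of_nat q ^ d)) :: rat fps"
  have "ask_zeta R P (Sym_mat d R) = ?A"
    unfolding ask_zeta_def reduce_Sym_mat[OF carr]
      transitive_mats.average_kernel[OF finite_chain_ring.transitive_mats_Sym[OF chain]] count ..
  moreover have "ask_zeta R P (gl_mat d R) = ?A"
    unfolding ask_zeta_def reduce_gl_mat[OF carr]
      transitive_mats.average_kernel[OF finite_chain_ring.transitive_mats_gl[OF chain]] count ..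
  ultimately show ?thesis by (simp add: fps_linear_coefficients)
qed

end
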